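(* For every election instance consisting of $k \ge 1$ offices with pairwise disjoint nonempty finite candidate sets $A_1,\dots,A_k$ and $n \ge 1$ voters with approval ballots $v_1,\dots,v_n \subseteq A = \bigcup_{j\in[k]} A_j$, there exists an office allocation $X$ satisfying Global Proportional Justified Representation.
   Context: Setting. $[k]=\{1,\dots,k\}$. There are $k$ offices; office $j$ has a nonempty finite set $A_j$ of candidates, the sets $A_1,\dots,A_k$ are pairwise disjoint, and $A=\bigcup_{j\in[k]}A_j$. There are $n$ voters $V=\{v_1,\dots,v_n\}$; each voter $v$ is identified with her approval ballot $v\subseteq A$ (different voters may have identical ballots and are still counted separately, so $|V|=n$). An office allocation is a set $X=\{w_1,\dots,w_k\}$ with $w_j\in A_j$ for every $j\in[k]$. Definition (Global Proportional Justified Representation). An office allocation $X$ satisfies Global Proportional Justified Representation if for every nonempty group of voters $V'\subseteq V$ the following holds: if $\left(\bigcap_{v\in V'}v\right)\cap A_j\neq\emptyset$ for all $j\in[k]$, then $\left|X\cap\left(\bigcup_{v\in V'}v\right)\right|\ge\left\lfloor\frac{|V'|}{|V|}\,k\right\rfloor$. *)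

theory Defs
  imports Complex_Main "HOL-Library.Disjoint_Sets"
begin

text \<open>
  Voters are indices in \<open>{1..n}\<close> and \<open>b i\<close> is the ballot of voter \<open>i\<close>, so that voters with
  identical ballots are counted separately.
\<close>

definition election_instance :: "nat \<Rightarrow> (nat \<Rightarrow> 'c set) \<Rightarrow> nat \<Rightarrow> (nat \<Rightarrow> 'c set) \<Rightarrow> bool" where
  "election_instance k A n b \<longleftrightarrow>
     k \<ge> 1 \<and> n \<ge> 1 \<and>
     (\<forall>j\<in>{1..k}. finite (A j) \<and> A j \<noteq> {}) \<and>
     disjoint_family_on A {1..k} \<and>
     (\<forall>i\<in>{1..n}. b i \<subseteq> (\<Union>j\<in>{1..k}. A j))"

definition office_allocation :: "nat \<Rightarrow> (nat \<Rightarrow> 'c set) \<Rightarrow> 'c set \<Rightarrow> bool" where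
  "office_allocation k A X \<longleftrightarrow> (\<exists>w. (\<forall>j\<in>{1..k}. w j \<in> A j) \<and> X = w ` {1..k})"

definition global_PJR ::
    "nat \<Rightarrow> (nat \<Rightarrow> 'c set) \<Rightarrow> nat \<Rightarrow> (nat \<Rightarrow> 'c set) \<Rightarrow> 'c set \<Rightarrow> bool" where
  "global_PJR k A n b X \<longleftrightarrow>
     (\<forall>V' \<subseteq> {1..n}. V' \<noteq> {} \<longrightarrow>
        (\<forall>j\<in>{1..k}. (\<Inter>i\<in>V'. b i) \<inter> A j \<noteq> {}) \<longrightarrow>
        int (card (X \<inter> (\<Union>i\<in>V'. b i))) \<ge> \<lfloor>real (card V') / real n * real k\<rfloor>)"

end

theory Submission
  imports Defs
begin

text \<open>
  Greedy argument: take a largest cohesive group \<open>M\<close> of the remaining voters, spend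
  \<open>\<lfloor>|M| k / n\<rfloor>\<close> of the unused offices on candidates that all of \<open>M\<close> approve, and remove \<open>M\<close>.
  The offices suffice because each removed group uses at most its proportional share.
  When a cohesive group \<open>V'\<close> first loses a member \<open>i\<close>, the group removed is at least as
  large as \<open>V'\<close>, so \<open>i\<close> alone already approves \<open>\<lfloor>|V'| k / n\<rfloor>\<close> winners.
\<close>

definition cohesive :: "'o set \<Rightarrow> ('o \<Rightarrow> 'c set) \<Rightarrow> ('v \<Rightarrow> 'c set) \<Rightarrow> 'v set \<Rightarrow> bool" where
  "cohesive K A b V \<longleftrightarrow> V \<noteq> {} \<and> (\<forall>j\<in>K. (\<Inter>i\<in>V. b i) \<inter> A j \<noteq> {})"

text \<open>Here \<open>N\<close> holds the voters not yet removed and \<open>J\<close> the offices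
  not yet filled. The bound \<open>card N * k \<le> card J * n\<close> is the invariant: the open
  offices cover the proportional share of the remaining voters. Cohesion refers to the fixed set
  \<open>K\<close>, so it does not change while \<open>J\<close> shrinks.\<close>

lemma exists_choice_satisfying_member_of_each_cohesive_group:
  fixes A :: "'o \<Rightarrow> 'c set" and b :: "'v \<Rightarrow> 'c set" and k n :: nat
  assumes "n > 0" and "\<forall>j\<in>K. A j \<noteq> {}"
    and "finite N" "finite J" "J \<subseteq> K" "card N * k \<le> card J * n"
  shows "\<exists>w. (\<forall>j\<in>J. w j \<in> A j) \<and>
    (\<forall>V\<subseteq>N. cohesive K A b V \<longrightarrow> (\<exists>i\<in>V. card V * k div n \<le> card {j \<in> J. w j \<in> b i}))"
  using assms(3-)
proof (induction "card N" arbitrary: N J rule: less_induct)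
  case less
  show ?case
  proof (cases "\<exists>V\<subseteq>N. cohesive K A b V")
    case False
    \<comment> \<open>With no cohesive group left, any choice of candidates will do.\<close>
    have "\<forall>j\<in>J. (SOME c. c \<in> A j) \<in> A j"
      using assms(2) less.prems(3) by (auto simp: some_in_eq)
    then show ?thesis using False by (intro exI[of _ "\<lambda>j. SOME c. c \<in> A j"]) blast
  next
    case True
    let ?G = "{V. V \<subseteq> N \<and> cohesive K A b V}"
    have G: "finite ?G" "?G \<noteq> {}" using less.prems(1) True by auto
    obtain M where "M \<in> ?G" "card M = (MAX V\<in>?G. card V)"
      by (rule obtains_MAX[OF G, of card]) simp
    then have M: "M \<subseteq> N" "cohesive K A b M"
      and M_max: "\<And>V. V \<subseteq> N \<Longrightarrow> cohesive K A b V \<Longrightarrow> card V \<le> card M"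
      using G(1) by auto
    define l where "l = card M * k div n"
    have l: "l * n \<le> card M * k" by (simp add: l_def)
    have "card M * k \<le> card J * n"
      using card_mono[OF less.prems(1) M(1)] less.prems(4) mult_le_mono1 order_trans by blast
    then have "l * n \<le> card J * n" using l by linarith
    then have "l \<le> card J" using assms(1) by simp
    then obtain L where L: "L \<subseteq> J" "card L = l"
      by (metis obtain_subset_with_card_n)
    have card_N: "card (N - M) = card N - card M" and card_J: "card (J - L) = card J - l"
      using M(1) L less.prems(1,2) by (auto simp: card_Diff_subset finite_subset)
    \<comment> \<open>Strict because a cohesive group is nonempty.\<close>
    have "card (N - M) < card N"
      using M(1,2) less.prems(1) by (intro psubset_card_mono) (auto simp: cohesive_def)
    moreover have "card (N - M) * k \<le> card (J - L) * n"
      \<comment> \<open>Rounding \<open>l\<close> down preserves the invariant: \<open>l * n\<close>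
        is subtracted on the right, at least as much on the left.\<close>
      using l less.prems(4) unfolding card_N card_J by (simp add: diff_mult_distrib)
    ultimately obtain w where w: "\<forall>j\<in>J - L. w j \<in> A j"
      and w_sat: "\<And>V. V \<subseteq> N - M \<Longrightarrow> cohesive K A b V \<Longrightarrow>
        \<exists>i\<in>V. card V * k div n \<le> card {j \<in> J - L. w j \<in> b i}"
      using less.hyps[of "N - M" "J - L"] finite_Diff[OF less.prems(1)] finite_Diff[OF less.prems(2)]
        subset_trans[OF Diff_subset less.prems(3)] by blast
    have "\<forall>j\<in>L. \<exists>c. c \<in> (\<Inter>i\<in>M. b i) \<inter> A j"
      using M(2) L(1) less.prems(3) unfolding cohesive_def by blast
    then obtain u where u: "\<forall>j\<in>L. u j \<in> (\<Inter>i\<in>M. b i) \<inter> A j" by metis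
    let ?w = "\<lambda>j. if j \<in> L then u j else w j"
    have "\<exists>i\<in>V. card V * k div n \<le> card {j \<in> J. ?w j \<in> b i}"
      if V: "V \<subseteq> N" "cohesive K A b V" for V
    proof (cases "V \<inter> M = {}")
      case True
      \<comment> \<open>\<open>V\<close> survives the removal of \<open>M\<close>, and filling
        \<open>L\<close> can only add approved winners.\<close>
      then obtain i where "i \<in> V" "card V * k div n \<le> card {j \<in> J - L. w j \<in> b i}"
        using w_sat V by blast
      moreover have "card {j \<in> J - L. w j \<in> b i} \<le> card {j \<in> J. ?w j \<in> b i}"
        using less.prems(2) by (intro card_mono) auto
      ultimately show ?thesis using order_trans by blast
    next
      case False
      then obtain i where i: "i \<in> V" "i \<in> M" by blast
      have "card V * k div n \<le> card L"
        using M_max[OF V] by (simp add: L(2) l_def div_le_mono)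
      also have "\<dots> \<le> card {j \<in> J. ?w j \<in> b i}"
        using less.prems(2) L(1) u i(2) by (intro card_mono) auto
      finally show ?thesis using i(1) by blast
    qed
    moreover have "\<forall>j\<in>J. ?w j \<in> A j" using u w by auto
    ultimately show ?thesis by (intro exI[of _ ?w] conjI allI impI)
  qed
qed

theorem proposition2:
  fixes k n :: nat and A :: "nat \<Rightarrow> 'c set" and b :: "nat \<Rightarrow> 'c set"
  assumes "election_instance k A n b"
  shows "\<exists>X. office_allocation k A X \<and> global_PJR k A n b X"
proof -
  have "n > 0" and nonempty: "\<forall>j\<in>{1..k}. A j \<noteq> {}"
    and disj: "disjoint_family_on A {1..k}"
    using assms by (auto simp: election_instance_def)
  have "card {1..n} * k \<le> card {1..k} * n" by simp
  from exists_choice_satisfying_member_of_each_cohesive_group[OF \<open>n > 0\<close> nonempty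
      finite_atLeastAtMost finite_atLeastAtMost subset_refl this, where b = b]
  obtain w where w: "\<forall>j\<in>{1..k}. w j \<in> A j"
    and w_sat: "\<forall>V\<subseteq>{1..n}. cohesive {1..k} A b V \<longrightarrow>
      (\<exists>i\<in>V. card V * k div n \<le> card {j \<in> {1..k}. w j \<in> b i})"
    by blast
  \<comment> \<open>Disjoint candidate sets make counting offices the same as counting
    winners.\<close>
  have inj: "inj_on w {1..k}"
    using w disj unfolding inj_on_def disjoint_family_on_def by (metis disjoint_iff)
  have "global_PJR k A n b (w ` {1..k})"
    unfolding global_PJR_def
  proof (intro allI impI)
    fix V assume V: "V \<subseteq> {1..n}" "V \<noteq> {}" "\<forall>j\<in>{1..k}. (\<Inter>i\<in>V. b i) \<inter> A j \<noteq> {}"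
    then have "cohesive {1..k} A b V" by (simp only: cohesive_def simp_thms)
    then obtain i where i: "i \<in> V" "card V * k div n \<le> card {j \<in> {1..k}. w j \<in> b i}"
      using w_sat V(1) by blast
    note i(2)
    also have "card {j \<in> {1..k}. w j \<in> b i} = card (w ` {j \<in> {1..k}. w j \<in> b i})"
      by (rule card_image[symmetric], rule inj_on_subset[OF inj]) blast
    \<comment> \<open>The ballot of the single voter \<open>i\<close> lies in the union over
      \<open>V\<close>.\<close>
    also have "\<dots> \<le> card (w ` {1..k} \<inter> (\<Union>i\<in>V. b i))"
      using i(1) by (intro card_mono) auto
    finally have "int (card V * k div n) \<le> int (card (w ` {1..k} \<inter> (\<Union>i\<in>V. b i)))"
      by (simp only: of_nat_le_iff)
    moreover have "\<lfloor>real (card V) / real n * real k\<rfloor> = int (card V * k div n)"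
      using floor_divide_of_nat_eq[of "card V * k" n, where ?'a = real] by simp
    ultimately show "\<lfloor>real (card V) / real n * real k\<rfloor> \<le> int (card (w ` {1..k} \<inter> (\<Union>i\<in>V. b i)))"
      by (simp only:)
  qed
  then show ?thesis using w unfolding office_allocation_def by blast
qed

end
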